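(* Let $k \geq 2$ be an integer. Let $G$ be a finite simple graph with $|V(G)| = \gamma k$ where $\gamma \geq \frac{5}{2}$, and suppose that $\frac{1}{k^2}|E(G)| > \frac{19}{12}(\gamma - 1)$. Then $G$ contains a $(k+1)$-connected subgraph. Equivalently, every $n$-vertex graph with $n \geq \frac{5}{2}k$ and more than $\frac{19}{12}k(n-k)$ edges contains a $(k+1)$-connected subgraph.
   Context: All graphs are finite, undirected and simple. A graph $H$ is $(k+1)$-connected if for every set $S \subseteq V(H)$ with $|S| = k$, the graph $H - S$ (obtained by deleting $S$) is connected and has at least two vertices; in particular $|V(H)| \geq k+2$. *)

theory Defs
  imports Complex_Main
begin

text \<open>A finite simple graph: finite vertex set V, edges are 2-element subsets of V.\<close>
definition simple_graph :: "'a set \<Rightarrow> 'a set set \<Rightarrow> bool" where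
  "simple_graph V E \<longleftrightarrow> finite V \<and>
     (\<forall>e\<in>E. \<exists>u v. e = {u, v} \<and> u \<noteq> v \<and> u \<in> V \<and> v \<in> V)"

definition subgraph :: "'a set \<Rightarrow> 'a set set \<Rightarrow> 'a set \<Rightarrow> 'a set set \<Rightarrow> bool" where
  "subgraph V' E' V E \<longleftrightarrow> V' \<subseteq> V \<and> E' \<subseteq> E \<and> (\<forall>e\<in>E'. e \<subseteq> V')"

definition adj_rel :: "'a set \<Rightarrow> 'a set set \<Rightarrow> ('a \<times> 'a) set" where
  "adj_rel V E = {(u, v). u \<in> V \<and> v \<in> V \<and> {u, v} \<in> E}"

definition graph_connected :: "'a set \<Rightarrow> 'a set set \<Rightarrow> bool" where
  "graph_connected V E \<longleftrightarrow> (\<forall>u\<in>V. \<forall>v\<in>V. (u, v) \<in> (adj_rel V E)\<^sup>*)"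

text \<open>Deleting a vertex set S from the graph (V, E).\<close>
definition del_vertices_V :: "'a set \<Rightarrow> 'a set \<Rightarrow> 'a set" where
  "del_vertices_V V S = V - S"

definition del_vertices_E :: "'a set set \<Rightarrow> 'a set \<Rightarrow> 'a set set" where
  "del_vertices_E E S = {e \<in> E. e \<inter> S = {}}"

text \<open>(k+1)-connectedness, as in the paper: for every S of size k, H - S is connected
  and has at least two vertices; in particular |V(H)| \<ge> k+2.\<close>
definition kplus1_connected :: "nat \<Rightarrow> 'a set \<Rightarrow> 'a set set \<Rightarrow> bool" where
  "kplus1_connected k V E \<longleftrightarrow> card V \<ge> k + 2 \<and>
     (\<forall>S. S \<subseteq> V \<and> card S = k \<longrightarrow>
        graph_connected (del_vertices_V V S) (del_vertices_E E S) \<and>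
        card (del_vertices_V V S) \<ge> 2)"

end

(* Separate G by k vertices into sides of sizes a and b and induct on the number of vertices.
   Repeatedly deleting the smaller side of a separation shows that k + d vertices span at most
   k^2/2 + kd + d^2/6 edges, which is at most 19/12 kd exactly for 3k/2 <= d <= 2k; this covers
   the orders from 5k/2 to 3k. For larger orders one also needs a bound on the edges meeting a
   side A. The same deletion process, run on A together with its separator S, does not count edges
   inside S: each part removed from S, and the part of S left at the end, contributes half
   the square of its size to the saving. The function saving bounds the total from below. *)
theory Submission
  imports Defs
begin

section \<open>Edges off a set, separations and the saving\<close>

text \<open>With \<open>S = {}\<close> these are all edges spanned by \<open>U\<close>, since edges
  of a simple graph are nonempty. With \<open>S\<close> a separator, they are what one side adds to
  edges already counted on the other.\<close>

definition edges_off :: "'a set set \<Rightarrow> 'a set \<Rightarrow> 'a set \<Rightarrow> 'a set set" where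
  "edges_off E U S = {e \<in> E. e \<subseteq> U \<and> \<not> e \<subseteq> S}"

text \<open>The absence of edges between \<open>X\<close> and \<open>Y\<close> is stated as
  containment in a side with its separator, the form used to split edge counts.\<close>

definition separation :: "nat \<Rightarrow> 'a set set \<Rightarrow> 'a set \<Rightarrow> 'a set \<Rightarrow> 'a set \<Rightarrow> 'a set \<Rightarrow> bool" where
  "separation k E U X C Y \<longleftrightarrow> U = X \<union> C \<union> Y \<and> X \<inter> C = {} \<and> Y \<inter> C = {} \<and> X \<inter> Y = {} \<and>
     X \<noteq> {} \<and> Y \<noteq> {} \<and> card C = k \<and> (\<forall>e\<in>E. e \<subseteq> U \<longrightarrow> e \<subseteq> X \<union> C \<or> e \<subseteq> Y \<union> C)"

text \<open>For s = k the middle branch is twice the excess of k^2/2 + kd + d^2/6 over 19/12 kd; the factor 2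
  pays for the excess on the other side of a separation as well. The last branch comes from
  counting all pairs of vertices not inside S.\<close>
definition saving :: "real \<Rightarrow> real \<Rightarrow> real" where
  "saving d s = (if 3 * s \<le> 2 * d then 0
     else if s \<le> d then (3 * s - 2 * d) * (2 * s - d) / 6
     else s\<^sup>2 / 2 - d\<^sup>2 / 3)"

section \<open>Inequalities for the saving\<close>

lemma saving_0: "d \<ge> 0 \<Longrightarrow> saving d 0 = 0"
  by (simp add: saving_def)

lemma saving_nonneg:
  assumes "0 \<le> d"
  shows "0 \<le> saving d s"
proof -
  have "d\<^sup>2 \<le> s\<^sup>2" if "d < s" using assms that by (intro power_mono) auto
  then have "0 \<le> s\<^sup>2 / 2 - d\<^sup>2 / 3" if "d < s" using that zero_le_power2[of s] by linarith
  then show ?thesis by (auto simp: saving_def)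
qed

text \<open>At \<open>s = d\<close> an earlier branch applies, but its value is also
  \<open>d\<^sup>2 / 6\<close>, so the pair-counting formula extends to that point.\<close>

lemma saving_ge_pairs:
  assumes "d \<le> s" "0 \<le> d"
  shows "saving d s = s\<^sup>2 / 2 - d\<^sup>2 / 3"
proof (cases "s = d")
  case True
  then show ?thesis using assms by (auto simp: saving_def power2_eq_square)
next
  case False
  then show ?thesis using assms by (auto simp: saving_def)
qed

text \<open>Deleting a side of \<open>x\<close> vertices, \<open>q\<close> of them in
  \<open>S\<close>, removes at most (x^2 - q^2)/2 + kx counted edges, while k^2/2 + kd + d^2/6 drops
  by kx + (2dx - x^2)/6. The gain is q^2/2 + x(d - 2x)/3. The smaller side is deleted, hence
  \<open>2 * x \<le> d\<close>. The cases follow the branches of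
  \<open>saving (d - x) (s - q)\<close>.\<close>

lemma saving_step:
  fixes d s x q :: real
  assumes q: "0 \<le> q" "q \<le> x" and x: "2 * x \<le> d" and s: "s \<le> d"
  shows "saving d s \<le> q\<^sup>2 / 2 + x * (d - 2 * x) / 3 + saving (d - x) (s - q)"
proof -
  have nn: "0 \<le> q\<^sup>2 / 2 + x * (d - 2 * x) / 3" using q x by auto
  have d0: "0 \<le> d - x" using q x by auto
  show ?thesis
  proof (cases "3 * s \<le> 2 * d")
    case True
    then show ?thesis using nn saving_nonneg[OF d0, of "s - q"] by (simp add: saving_def)
  next
    case F: False
    have W: "saving d s = (3 * s - 2 * d) * (2 * s - d) / 6" using F s by (simp add: saving_def)
    define p where "p = x - q"
    have p: "0 \<le> p" using q by (simp add: p_def)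
    consider "3 * (s - q) \<le> 2 * (d - x)" | "d - x \<le> s - q"
      | "\<not> 3 * (s - q) \<le> 2 * (d - x)" "s - q \<le> d - x" by linarith
    then show ?thesis
    proof cases
      case 1
      \<comment> \<open>The case gives s \<le> q + 2(d - x)/3, and each factor increases with
        \<open>s\<close>, so it is at most its value there. The first factor is positive, hence 3q >
        2x.\<close>
      have "(3 * s - 2 * d) * (2 * s - d) \<le> (3 * q - 2 * x) * (d / 3 + 2 * q - 4 * x / 3)"
        using 1 F q x s by (intro mult_mono) auto
      also have "\<dots> \<le> 3 * q\<^sup>2 + 2 * x * (d - 2 * x)"
      proof -
        have "0 \<le> (d - 2 * x) * (8 * x / 3 - q)" using q x by auto
        moreover have "0 \<le> (3 * q - 2 * x) * (x - q)" using 1 F q by auto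
        moreover have "0 \<le> x * q" "0 \<le> x * x" using q by auto
        moreover have "3 * q\<^sup>2 + 2 * x * (d - 2 * x) - (3 * q - 2 * x) * (d / 3 + 2 * q - 4 * x / 3)
          = (d - 2 * x) * (8 * x / 3 - q) + (3 * q - 2 * x) * (x - q) + x * q + 2 / 3 * (x * x)"
          by (simp add: power2_eq_square field_simps)
        ultimately show ?thesis by linarith
      qed
      finally show ?thesis using 1 W by (simp add: saving_def)
    next
      case 2
      \<comment> \<open>In terms of \<open>e\<close> and \<open>p\<close> the case says e \<le> p,
        and the difference to be shown nonnegative expands into products of nonnegative
        terms.\<close>
      define e where "e = d - s"
      have e: "0 \<le> e" "e \<le> p" using 2 s by (auto simp: e_def p_def)
      have "0 \<le> (d - 2 * x) * (6 * p - e)" using e x by auto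
      moreover have "0 \<le> e * q" using e q by auto
      moreover have "0 \<le> (p - e) * p" "0 \<le> (p - e) * e" using e by auto
      moreover have "0 \<le> p * p" by simp
      moreover have "6 * (q\<^sup>2 / 2 + x * (d - 2 * x) / 3 + ((s - q)\<^sup>2 / 2 - (d - x)\<^sup>2 / 3))
          - (3 * s - 2 * d) * (2 * s - d)
        = (d - 2 * x) * (6 * p - e) + 4 * (e * q) + 5 * ((p - e) * p) + 3 * ((p - e) * e) + p * p"
        by (simp add: p_def e_def power2_eq_square field_simps)
      ultimately have "(3 * s - 2 * d) * (2 * s - d)
          \<le> 6 * (q\<^sup>2 / 2 + x * (d - 2 * x) / 3 + ((s - q)\<^sup>2 / 2 - (d - x)\<^sup>2 / 3))"
        by linarith
      then show ?thesis using W saving_ge_pairs[OF 2 d0] by simp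
    next
      case 3
      \<comment> \<open>Six times the left side minus the right side of the goal. The squares of
        \<open>s\<close> cancel, so it is linear in \<open>s\<close> on 2d/3 < s \<le> d - p; the
        sign of 12q - 7x decides which end bounds it.\<close>
      have "s * (12 * q - 7 * x) - 7 * q * d + 7 * q * x - 9 * q\<^sup>2 + 2 * d * x + 2 * x\<^sup>2 \<le> 0"
        (is "?w \<le> 0")
      proof (cases "12 * q \<ge> 7 * x")
        case True
        have "0 \<le> (d - p - s) * (12 * q - 7 * x)" using True 3 by (auto simp: p_def)
        moreover have "0 \<le> (d - 2 * x) * (5 * p)" using x p by auto
        moreover have "0 \<le> p * (3 * q + x)" using p q by auto
        ultimately show ?thesis by (simp add: p_def power2_eq_square algebra_simps)
      next
        case False
        have "0 \<le> (3 * s - 2 * d) * (7 * x - 12 * q)" using False F by auto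
        moreover have "0 \<le> (d - 2 * x) * (8 * x - 3 * q)" using x q by auto
        moreover have "0 \<le> (2 * q - x)\<^sup>2" "0 \<le> x * x" by auto
        moreover have "- 12 * ?w
          = 4 * ((3 * s - 2 * d) * (7 * x - 12 * q)) + 4 * ((d - 2 * x) * (8 * x - 3 * q))
            + 27 * (2 * q - x)\<^sup>2 + 13 * (x * x)"
          by (simp add: power2_eq_square algebra_simps)
        ultimately have "0 \<le> - 12 * ?w" by simp
        then show ?thesis by simp
      qed
      then have "(3 * s - 2 * d) * (2 * s - d)
          \<le> 3 * q\<^sup>2 + 2 * x * (d - 2 * x) + (3 * (s - q) - 2 * (d - x)) * (2 * (s - q) - (d - x))"
        by (simp add: power2_eq_square algebra_simps)
      then show ?thesis using W 3 by (simp add: saving_def)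
    qed
  qed
qed

section \<open>Separations from failing connectivity\<close>

lemma simple_graph_edge:
  assumes "simple_graph V E" "e \<in> E"
  obtains u v where "e = {u, v}" "u \<noteq> v" "u \<in> V" "v \<in> V"
  using assms unfolding simple_graph_def by blast

lemma finite_edges: "simple_graph V E \<Longrightarrow> finite E"
  by (rule finite_subset[of _ "Pow V"]) (auto simp: simple_graph_def)

lemma finite_edges_off: "simple_graph V E \<Longrightarrow> finite (edges_off E U S)"
  using finite_edges[of V E] by (simp add: edges_off_def)

lemma disconnected_split:
  assumes "\<not> graph_connected W F"
  obtains X Y where "W = X \<union> Y" "X \<inter> Y = {}" "X \<noteq> {}" "Y \<noteq> {}"
    "\<And>x y. x \<in> X \<Longrightarrow> y \<in> Y \<Longrightarrow> {x, y} \<notin> F"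
proof -
  obtain u v where uv: "u \<in> W" "v \<in> W" "(u, v) \<notin> (adj_rel W F)\<^sup>*"
    using assms by (auto simp: graph_connected_def)
  define X where "X = {w \<in> W. (u, w) \<in> (adj_rel W F)\<^sup>*}"
  have "{x, y} \<notin> F" if xy: "x \<in> X" "y \<in> W - X" for x y
  proof
    assume "{x, y} \<in> F"
    then have "(x, y) \<in> adj_rel W F" using xy by (auto simp: adj_rel_def X_def)
    then have "y \<in> X" using xy by (auto simp: X_def intro: rtrancl_into_rtrancl)
    then show False using xy by simp
  qed
  then show thesis using uv by (intro that[of X "W - X"]) (auto simp: X_def)
qed

lemma separation_commute: "separation k E U X C Y \<Longrightarrow> separation k E U Y C X"
  unfolding separation_def by blast

text \<open>Some k-set \<open>C\<close> violates the definition. At least two vertices remain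
  outside it, so the violation is a disconnection; the sides may be swapped to put the smaller
  first.\<close>

lemma separation_exists:
  assumes G: "simple_graph V E" and U: "U \<subseteq> V" "card U \<ge> k + 2"
    and nc: "\<not> kplus1_connected k U {e \<in> E. e \<subseteq> U}"
  obtains X C Y where "separation k E U X C Y" "card X \<le> card Y"
proof -
  let ?F = "{e \<in> E. e \<subseteq> U}"
  have fU: "finite U" using G U finite_subset by (auto simp: simple_graph_def)
  obtain C where C: "C \<subseteq> U" "card C = k"
    and bad: "\<not> (graph_connected (U - C) (del_vertices_E ?F C) \<and> card (U - C) \<ge> 2)"
    using nc U(2) unfolding kplus1_connected_def del_vertices_V_def by blast
  have "card (U - C) \<ge> 2" using C U fU by (simp add: card_Diff_subset finite_subset)
  then have "\<not> graph_connected (U - C) (del_vertices_E ?F C)" using bad by blast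
  then obtain X Y where XY: "U - C = X \<union> Y" "X \<inter> Y = {}" "X \<noteq> {}" "Y \<noteq> {}"
    and no: "\<And>x y. x \<in> X \<Longrightarrow> y \<in> Y \<Longrightarrow> {x, y} \<notin> del_vertices_E ?F C"
    by (rule disconnected_split) blast
  have "e \<subseteq> X \<union> C \<or> e \<subseteq> Y \<union> C" if e: "e \<in> E" "e \<subseteq> U" for e
  proof (rule ccontr)
    assume *: "\<not> ?thesis"
    obtain u v where uv: "e = {u, v}" using G e(1) by (rule simple_graph_edge)
    have "u \<in> X \<and> v \<in> Y \<or> v \<in> X \<and> u \<in> Y" using * uv e XY by blast
    then obtain x y where xy: "x \<in> X" "y \<in> Y" "e = {x, y}" using uv by blast
    then have "e \<in> del_vertices_E ?F C" using e XY unfolding del_vertices_E_def by blast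
    then show False using no xy by blast
  qed
  then have sep: "separation k E U X C Y"
    using XY C unfolding separation_def by blast
  show thesis
  proof (cases "card X \<le> card Y")
    case True
    then show ?thesis using that sep by blast
  next
    case False
    then show ?thesis using that separation_commute[OF sep] by simp
  qed
qed

lemma separation_card:
  assumes "separation k E U X C Y" "finite U"
  shows "card U = card X + k + card Y" "card (X \<union> C) = k + card X" "card (Y \<union> C) = k + card Y"
    "card X \<ge> 1" "card Y \<ge> 1"
proof -
  have f: "finite X" "finite Y" "finite C" using assms by (auto simp: separation_def)
  show "card (X \<union> C) = k + card X" "card (Y \<union> C) = k + card Y" "card X \<ge> 1" "card Y \<ge> 1"
    using assms f by (auto simp: separation_def card_Un_disjoint Suc_le_eq card_gt_0_iff)
  have "(X \<union> C) \<inter> Y = {}" using assms by (auto simp: separation_def)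
  then show "card U = card X + k + card Y"
    using assms f by (auto simp: separation_def card_Un_disjoint)
qed

section \<open>Counting edges off a set\<close>

lemma real_choose_2: "real (n choose 2) = real n * (real n - 1) / 2"
  by (induction n) (auto simp: numeral_2_eq_2 field_simps)

text \<open>The exact count is a difference of binomials n(n - 1)/2 - m(m - 1)/2; the term -(n -
  m)/2 is dropped, as m \<le> n.\<close>

lemma card_pairs_off_le:
  assumes fin: "finite U"
  shows "real (card {e. e \<subseteq> U \<and> card e = 2 \<and> \<not> e \<subseteq> S}) \<le> ((real (card U))\<^sup>2 - (real (card (U \<inter> S)))\<^sup>2) / 2"
proof -
  let ?P = "\<lambda>W. {e. e \<subseteq> W \<and> card e = 2}"
  have "{e. e \<subseteq> U \<and> card e = 2 \<and> \<not> e \<subseteq> S} = ?P U - ?P (U \<inter> S)" by auto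
  moreover have "card (?P U - ?P (U \<inter> S)) = card (?P U) - card (?P (U \<inter> S))"
    using fin by (intro card_Diff_subset) auto
  moreover have "card (?P (U \<inter> S)) \<le> card (?P U)" using fin by (intro card_mono) auto
  ultimately have "real (card {e. e \<subseteq> U \<and> card e = 2 \<and> \<not> e \<subseteq> S})
      = real (card U choose 2) - real (card (U \<inter> S) choose 2)"
    using n_subsets[OF fin, of 2] n_subsets[OF finite_Int[OF disjI1[OF fin]], of S 2]
    by (simp only: of_nat_diff)
  moreover have "card (U \<inter> S) \<le> card U" using fin by (intro card_mono) auto
  ultimately show ?thesis by (simp add: real_choose_2 power2_eq_square field_simps)
qed

lemma card_edges_off_le:
  assumes G: "simple_graph V E" and U: "U \<subseteq> V"
  shows "real (card (edges_off E U S)) \<le> ((real (card U))\<^sup>2 - (real (card (U \<inter> S)))\<^sup>2) / 2"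
proof -
  have fU: "finite U" using G U finite_subset by (auto simp: simple_graph_def)
  have "card (edges_off E U S) \<le> card {e. e \<subseteq> U \<and> card e = 2 \<and> \<not> e \<subseteq> S}"
    using fU by (intro card_mono) (auto simp: edges_off_def elim!: simple_graph_edge[OF G])
  then show ?thesis using card_pairs_off_le[OF fU, of S] by linarith
qed

text \<open>An edge lies in \<open>Y \<union> C\<close>, lies in \<open>X\<close>, or joins
  \<open>X\<close> to \<open>C\<close>. Edges of the last kind number at most k per vertex of
  \<open>X\<close>.\<close>

lemma card_edges_off_side:
  assumes G: "simple_graph V E" and U: "U \<subseteq> V" and sep: "separation k E U X C Y"
  shows "real (card (edges_off E U S)) \<le> real (card (edges_off E (Y \<union> C) S))
    + ((real (card X))\<^sup>2 - (real (card (X \<inter> S)))\<^sup>2) / 2 + real k * real (card X)"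
proof -
  have fin: "finite X" "finite C"
    using sep G U finite_subset by (auto simp: simple_graph_def separation_def)
  let ?M = "(\<lambda>(x, c). {x, c}) ` (X \<times> C)"
  have "edges_off E U S \<subseteq> edges_off E (Y \<union> C) S \<union> edges_off E X S \<union> ?M"
  proof
    fix e assume e: "e \<in> edges_off E U S"
    then have "e \<in> E" by (simp add: edges_off_def)
    then obtain u v where uv: "e = {u, v}" using G by (blast elim: simple_graph_edge)
    have "e \<subseteq> Y \<union> C \<or> e \<subseteq> X \<or> (\<exists>x\<in>X. \<exists>c\<in>C. e = {x, c})"
      using e sep uv unfolding edges_off_def separation_def by blast
    then show "e \<in> edges_off E (Y \<union> C) S \<union> edges_off E X S \<union> ?M"
      using e by (auto simp: edges_off_def)
  qed
  then have "card (edges_off E U S) \<le> card (edges_off E (Y \<union> C) S \<union> edges_off E X S \<union> ?M)"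
    using fin by (intro card_mono) (auto simp: finite_edges_off[OF G])
  also have "\<dots> \<le> card (edges_off E (Y \<union> C) S) + card (edges_off E X S) + card ?M"
    by (meson add_le_mono card_Un_le le_refl le_trans)
  also have "card ?M \<le> card X * k"
    using card_image_le[of "X \<times> C" "\<lambda>(x, c). {x, c}"] fin sep
    by (simp add: card_cartesian_product separation_def)
  finally have "real (card (edges_off E U S)) \<le> real (card (edges_off E (Y \<union> C) S))
      + real (card (edges_off E X S)) + real (card X) * real k"
    by (metis add_left_mono of_nat_add of_nat_le_iff of_nat_mult)
  moreover have "X \<subseteq> V" using sep U by (auto simp: separation_def)
  ultimately show ?thesis using card_edges_off_le[OF G, of X S] mult.commute[of "real k" "real (card X)"] by linarith
qed

lemma card_edges_off_bound:
  assumes G: "simple_graph V E"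
    and nc: "\<And>U. U \<subseteq> V \<Longrightarrow> \<not> kplus1_connected k U {e \<in> E. e \<subseteq> U}"
    and U: "U \<subseteq> V" "card U = k + d"
  shows "real (card (edges_off E U S)) \<le> (real k)\<^sup>2 / 2 + real k * real d + (real d)\<^sup>2 / 6
    - saving (real d) (real (card (U \<inter> S)))"
  using U
proof (induction d arbitrary: U rule: less_induct)
  case (less d)
  have fU: "finite U" using G less.prems finite_subset by (auto simp: simple_graph_def)
  let ?s = "real (card (U \<inter> S))"
  note triv = card_edges_off_le[OF G less.prems(1), of S]
  consider "d \<le> card (U \<inter> S)" | "card (U \<inter> S) = 0" "d = 1" | "card (U \<inter> S) < d" "d \<ge> 2" by linarith
  then show ?case
  proof cases
    case 1
    \<comment> \<open>Counting pairs gives exactly the claim, since (d^2 - s^2)/2 = d^2/6 - (s^2/2 -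
      d^2/3).\<close>
    then show ?thesis using triv saving_ge_pairs[of "real d" ?s] less.prems(2)
      by (simp add: power2_eq_square field_simps)
  next
    case 2
    \<comment> \<open>With k + 1 vertices no separation is available, and (k + 1)^2/2 exceeds the
      claim; the exact binomial count is needed.\<close>
    have "card (edges_off E U S) \<le> card {e. e \<subseteq> U \<and> card e = 2}"
      using fU by (intro card_mono) (auto simp: edges_off_def elim!: simple_graph_edge[OF G])
    then have "real (card (edges_off E U S)) \<le> real (k + 1) * real k / 2"
      using 2 less.prems(2) fU real_choose_2[of "k + 1"] by (simp add: n_subsets)
    moreover have "saving (real d) ?s = 0" using 2 saving_0[of 1] by simp
    moreover have "real (k + 1) * real k / 2 \<le> (real k)\<^sup>2 / 2 + real k"
      by (simp add: power2_eq_square field_simps)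
    ultimately show ?thesis using 2 by simp
  next
    case 3
    obtain X C Y where sep: "separation k E U X C Y" and le: "card X \<le> card Y"
      using separation_exists[OF G less.prems(1) _ nc[OF less.prems(1)]] less.prems(2) 3 by auto
    note c = separation_card[OF sep fU]
    have YC: "Y \<union> C \<subseteq> V" "card (Y \<union> C) = k + (d - card X)" "d - card X < d"
      using sep c less.prems by (auto simp: separation_def)
    have "(U \<inter> S) = (X \<inter> S) \<union> ((Y \<union> C) \<inter> S)" "(X \<inter> S) \<inter> ((Y \<union> C) \<inter> S) = {}"
      using sep by (auto simp: separation_def)
    moreover have "finite X" "finite (Y \<union> C)" using fU sep by (auto simp: separation_def)
    ultimately have cs: "card (U \<inter> S) = card (X \<inter> S) + card ((Y \<union> C) \<inter> S)"
      by (simp add: card_Un_disjoint)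
    have qx: "card (X \<inter> S) \<le> card X" using \<open>finite X\<close> by (intro card_mono) auto
    let ?x = "real (card X)" and ?q = "real (card (X \<inter> S))" and ?d = "real d"
    have dx: "real (d - card X) = ?d - ?x" using c less.prems by simp
    have ss: "real (card ((Y \<union> C) \<inter> S)) = ?s - ?q" using cs by simp
    have "2 * card X \<le> d" using c le less.prems by simp
    then have "2 * ?x \<le> ?d" by linarith
    then have step: "saving ?d ?s \<le> ?q\<^sup>2 / 2 + ?x * (?d - 2 * ?x) / 3 + saving (?d - ?x) (?s - ?q)"
      using qx 3 by (intro saving_step) auto
    have "real (card (edges_off E (Y \<union> C) S)) \<le> (real k)\<^sup>2 / 2 + real k * (?d - ?x) + (?d - ?x)\<^sup>2 / 6
        - saving (?d - ?x) (?s - ?q)"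
      using less.IH[OF YC(3,1,2)] unfolding dx ss .
    moreover note card_edges_off_side[OF G less.prems(1) sep, of S]
    ultimately show ?thesis using step by (simp add: power2_eq_square field_simps)
  qed
qed

section \<open>The bound with constant 19/12\<close>

lemma edge_bound:
  assumes G: "simple_graph V E"
    and nc: "\<And>U. U \<subseteq> V \<Longrightarrow> \<not> kplus1_connected k U {e \<in> E. e \<subseteq> U}"
    and k: "k \<ge> 2" and U: "U \<subseteq> V" "2 * card U \<ge> 5 * k"
  shows "real (card (edges_off E U {})) \<le> 19 / 12 * real k * (real (card U) - real k)"
  using U
proof (induction "card U" arbitrary: U rule: less_induct)
  case less
  let ?e = "\<lambda>U. real (card (edges_off E U {}))"
  have fU: "finite U" using G less.prems finite_subset by (auto simp: simple_graph_def)
  have F: "?e W \<le> (real k)\<^sup>2 / 2 + real k * real d + (real d)\<^sup>2 / 6"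
    if "W \<subseteq> V" "card W = k + d" for W d
    using card_edges_off_bound[OF G nc that, of "{}"] saving_0[of d] by simp
  show ?case
  proof (cases "card U \<le> 3 * k")
    case True
    define d where "d = card U - k"
    have d: "card U = k + d" "2 * d \<ge> 3 * k" "d \<le> 2 * k" using True less.prems by (auto simp: d_def)
    \<comment> \<open>This product is twelve times the excess of k^2/2 + kd + d^2/6 over 19/12
      kd.\<close>
    have "(2 * real d - 3 * real k) * (real d - 2 * real k) \<le> 0"
      using d by (intro mult_nonneg_nonpos) linarith+
    then show ?thesis using F[OF less.prems(1) d(1)] d(1)
      by (simp add: power2_eq_square field_simps)
  next
    case False
    obtain X C Y where sep: "separation k E U X C Y" and le: "card X \<le> card Y"
      using separation_exists[OF G less.prems(1) _ nc[OF less.prems(1)]] False k by auto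
    note c = separation_card[OF sep fU]
    define a b where "a = real (card X)" and "b = real (card Y)"
    define K where "K = real k"
    have n: "real (card U) = a + K + b" and ab: "a \<le> b" "a + b > 2 * K" "a \<ge> 1" and K: "K \<ge> 2"
      using c(1,4) False le k by (simp_all add: a_def b_def K_def)
    have XC: "X \<union> C \<subseteq> V" and YC: "Y \<union> C \<subseteq> V"
      using sep less.prems by (auto simp: separation_def)
    have ind: "?e (X \<union> C) \<le> 19 / 12 * K * a" if "2 * a \<ge> 3 * K"
    proof -
      have "card (X \<union> C) < card U" "5 * k \<le> 2 * card (X \<union> C)"
        using c that by (auto simp: a_def K_def)
      from less.hyps[OF this(1) XC this(2)] show ?thesis using c(2) by (simp add: K_def a_def)
    qed
    have indY: "?e (Y \<union> C) \<le> 19 / 12 * K * b" if "2 * b \<ge> 3 * K"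
    proof -
      have "card (Y \<union> C) < card U" "5 * k \<le> 2 * card (Y \<union> C)"
        using c that by (auto simp: b_def K_def)
      from less.hyps[OF this(1) YC this(2)] show ?thesis using c(3) by (simp add: K_def b_def)
    qed
    have FY: "?e (Y \<union> C) \<le> K\<^sup>2 / 2 + K * b + b\<^sup>2 / 6"
      using F[OF YC c(3)] by (simp add: K_def b_def)
    have touch: "real (card (edges_off E (X \<union> C) C)) \<le> K\<^sup>2 / 2 + K * a + a\<^sup>2 / 6 - saving a K"
    proof -
      have "(X \<union> C) \<inter> C = C" "card C = k" using sep by (auto simp: separation_def)
      then show ?thesis using card_edges_off_bound[OF G nc XC c(2), of C] by (simp add: K_def a_def)
    qed
    \<comment> \<open>Edges inside \<open>C\<close> are already counted with \<open>Y\<close>, so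
      \<open>X\<close> contributes only edges not inside \<open>C\<close>.\<close>
    have "edges_off E U {} \<subseteq> edges_off E (Y \<union> C) {} \<union> edges_off E (X \<union> C) C"
      using sep by (auto simp: edges_off_def separation_def)
    then have "card (edges_off E U {}) \<le> card (edges_off E (Y \<union> C) {} \<union> edges_off E (X \<union> C) C)"
      by (intro card_mono) (auto simp: finite_edges_off[OF G])
    also have "\<dots> \<le> card (edges_off E (Y \<union> C) {}) + card (edges_off E (X \<union> C) C)"
      by (rule card_Un_le)
    finally have split: "?e U \<le> ?e (Y \<union> C) + real (card (edges_off E (X \<union> C) C))"
      by linarith
    have W: "saving a K = (3 * K - 2 * a) * (2 * K - a) / 6" if "K \<le> a" "2 * a < 3 * K"
      using that by (simp add: saving_def)
    have T: "saving a K = K\<^sup>2 / 2 - a\<^sup>2 / 3" if "a \<le> K"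
      using saving_ge_pairs[OF that] ab by simp
    \<comment> \<open>A side of at least 3K/2 vertices has order at least 5K/2 together with
      \<open>C\<close>, so the induction hypothesis covers it; smaller sides need \<open>FY\<close>
      or \<open>touch\<close>.\<close>
    have "?e U \<le> 19 / 12 * K * (a + b)"
    proof (cases "2 * b \<ge> 3 * K")
      case bL: True
      have "real (card (edges_off E (X \<union> C) C)) \<le> 19 / 12 * K * a"
      proof (cases "2 * a \<ge> 3 * K")
        case True
        have "card (edges_off E (X \<union> C) C) \<le> card (edges_off E (X \<union> C) {})"
          by (intro card_mono finite_edges_off[OF G]) (auto simp: edges_off_def)
        then show ?thesis using ind[OF True] by linarith
      next
        case False
        show ?thesis
        proof (cases "a \<le> K")
          case True
          \<comment> \<open>Here \<open>touch\<close> reads Ka + a^2/2, which is at most 3/2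
            Ka.\<close>
          have "0 \<le> a * (K - a)" using True ab by auto
          moreover have "0 \<le> a * K" using ab K by auto
          ultimately show ?thesis using touch T[OF True] by (simp add: power2_eq_square field_simps)
        next
          case aK: False
          \<comment> \<open>The saving is twice the excess, so subtracting it leaves a nonpositive
            excess.\<close>
          have "0 \<le> (3 * K - 2 * a) * (2 * K - a)" using False aK by auto
          then show ?thesis using touch W aK False by (simp add: power2_eq_square field_simps)
        qed
      qed
      then show ?thesis using indY[OF bL] split by (simp add: algebra_simps)
    next
      case bS: False
      show ?thesis
      proof (cases "a \<le> K")
        case True
        \<comment> \<open>Twelve times the slack is (K - a)(6a - K) + (b - K)(5K - 2b), where 6a - K
          = 6(a + b - 2K) + (11K - 6b).\<close>
        have "0 \<le> (K - a) * (a + b - 2 * K)" using True ab by auto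
        moreover have "0 \<le> (K - a) * (11 * K - 6 * b)" using True K bS by auto
        moreover have "0 \<le> (b - K) * (5 * K - 2 * b)" using True ab K bS by auto
        ultimately show ?thesis using split FY touch T[OF True]
          by (simp add: power2_eq_square field_simps)
      next
        case False
        \<comment> \<open>With g(t) = (3K - 2t)(2K - t), the \<open>Y\<close> part exceeds its share
          by at most g(b)/12 and the \<open>X\<close> part by at most -g(a)/12. The product is g(a)
          - g(b), and a + b < 3K.\<close>
        have "0 \<le> (b - a) * (7 * K - 2 * a - 2 * b)" using ab bS by auto
        then show ?thesis using split FY touch W False ab bS
          by (simp add: power2_eq_square field_simps)
      qed
    qed
    then show ?thesis by (simp add: n K_def)
  qed
qed

section \<open>From the edge bound to the normalised statement\<close>

theorem theorem2:
  fixes V :: "'a set" and E :: "'a set set" and k :: nat and \<gamma> :: real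
  assumes "k \<ge> 2"
    and "simple_graph V E"
    and "real (card V) = \<gamma> * real k"
    and "\<gamma> \<ge> 5 / 2"
    and "real (card E) / (real k)\<^sup>2 > 19 / 12 * (\<gamma> - 1)"
  shows "\<exists>V' E'. subgraph V' E' V E \<and> kplus1_connected k V' E'"
proof (rule ccontr)
  assume no: "\<not> ?thesis"
  have nc: "\<not> kplus1_connected k U {e \<in> E. e \<subseteq> U}" if "U \<subseteq> V" for U
  proof -
    have "subgraph U {e \<in> E. e \<subseteq> U} V E" using that by (auto simp: subgraph_def)
    then show ?thesis using no by blast
  qed
  have "5 / 2 * real k \<le> real (card V)"
    unfolding assms(3) using assms(4) by (intro mult_right_mono) auto
  then have "5 * k \<le> 2 * card V" by linarith
  then have "real (card (edges_off E V {})) \<le> 19 / 12 * real k * (\<gamma> * real k - real k)"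
    using edge_bound[OF assms(2) nc assms(1) subset_refl] assms(3) by simp
  moreover have "edges_off E V {} = E"
    by (auto simp: edges_off_def elim: simple_graph_edge[OF assms(2)])
  ultimately have "real (card E) \<le> 19 / 12 * (\<gamma> - 1) * (real k)\<^sup>2"
    by (simp add: power2_eq_square algebra_simps)
  then have "real (card E) / (real k)\<^sup>2 \<le> 19 / 12 * (\<gamma> - 1)"
    using assms(1) by (simp add: divide_le_eq)
  then show False using assms(5) by simp
qed

end
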